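(* Let $H$ be a finite simple graph with vertex set $W$ and let $u,v\subset W$ be arbitrary (not necessarily disjoint) subsets. Let $G_1$ (resp. $G_0$) be the graph obtained from $H$ by adding two new vertices $p,q$, where the neighborhood of $p$ in $W$ is $u$, the neighborhood of $q$ in $W$ is $v$, and $p,q$ are joined by an edge (resp. are not joined by an edge). Let $G_c$ be the graph obtained from $H$ by adding one new vertex whose neighborhood is the symmetric difference $u\triangle v$. Then $$\phi(G_1)=-\phi(G_0)+\frac14\,\phi(G_c).$$
   Context: All graphs are finite and simple. $V(G)$, $E(G)$ are the vertex and edge sets of $G$. For $E'\subset E(G)$, $G|_{E'}$ is the spanning subgraph of $G$ with edge set $E'$ (same vertices). $\chi_3(H)$ is the number of proper colorings of the vertices of $H$ in three colors. The function $\phi$ on isomorphism classes of finite simple graphs is defined by $$\phi(G)=2^{-3|V(G)|}\sum_{E'\subset E(G)}(-2)^{|E'|}\chi_3(G|_{E'}).$$ *)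

theory Defs
  imports Complex_Main "HOL-Library.FuncSet"
begin

record 'a ugraph =
  verts :: "'a set"
  edges :: "'a set set"

definition simple_graph :: "'a ugraph \<Rightarrow> bool" where
  "simple_graph G \<longleftrightarrow>
     finite (verts G) \<and> (\<forall>e\<in>edges G. e \<subseteq> verts G \<and> card e = 2)"

definition spanning_subgraph :: "'a ugraph \<Rightarrow> 'a set set \<Rightarrow> 'a ugraph" where
  "spanning_subgraph G E' = \<lparr>verts = verts G, edges = E'\<rparr>"

text \<open>Colorings are extensional functions on the vertex set, so that they are
  counted only by their values on the vertices.\<close>

definition proper_3_colorings :: "'a ugraph \<Rightarrow> ('a \<Rightarrow> nat) set" where
  "proper_3_colorings G =
     {c \<in> verts G \<rightarrow>\<^sub>E {0, 1, 2}. \<forall>x y. {x, y} \<in> edges G \<longrightarrow> c x \<noteq> c y}"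

definition chi3 :: "'a ugraph \<Rightarrow> nat" where
  "chi3 G = card (proper_3_colorings G)"

definition phi :: "'a ugraph \<Rightarrow> real" where
  "phi G = 2 powi (- 3 * int (card (verts G))) *
     (\<Sum>E'\<in>Pow (edges G). (- 2) ^ card E' * real (chi3 (spanning_subgraph G E')))"

definition add_vertex :: "'a \<Rightarrow> 'a set \<Rightarrow> 'a ugraph \<Rightarrow> 'a ugraph" where
  "add_vertex p N G =
     \<lparr>verts = insert p (verts G), edges = edges G \<union> {{p, w} | w. w \<in> N}\<rparr>"

definition add_edge :: "'a \<Rightarrow> 'a \<Rightarrow> 'a ugraph \<Rightarrow> 'a ugraph" where
  "add_edge p q G = \<lparr>verts = verts G, edges = insert {p, q} (edges G)\<rparr>"

end

theory Submission
  imports Defs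
begin

text \<open>
  Exchanging the sum over \<^term>\<open>E'\<close> with the count of colorings turns \<^const>\<open>phi\<close> into the
  partition function of a three-state Potts model: for a fixed coloring, the
  alternating sum over the edge sets \<^term>\<open>E'\<close> on which the coloring is proper factors over the
  edges, a bichromatic edge contributing \<open>1 + (-2) = -1\<close> and a monochromatic one \<open>1\<close>. So,
  up to a power of two, \<^term>\<open>phi G\<close> sums over all colorings the product of these edge signs
  (\<open>phi_eq_sum_coloring_weight\<close>).

  Joining \<^term>\<open>p\<close> to \<^term>\<open>q\<close> multiplies the weight of a coloring by the sign of that edge.
  Hence in \<^term>\<open>phi G1 + phi G0\<close> every coloring of \<^term>\<open>G0\<close> carries the extra factor 2 or 0,
  according as \<^term>\<open>p\<close> and \<^term>\<open>q\<close> have the same color or not. When they do, the edges from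
  \<^term>\<open>p\<close> and \<^term>\<open>q\<close> to a common neighbor have equal signs, which cancel, so only the
  neighbors in \<^term>\<open>sym_diff u v\<close> contribute, and they do so just like the edges at the merged
  vertex of \<^term>\<open>Gc\<close>. The constant \<open>1/4\<close> is the factor 2 times \<open>2^-3\<close> for the one
  vertex by which the graphs differ.
\<close>

section \<open>Summation over colorings\<close>

definition colorings :: "'a ugraph \<Rightarrow> ('a \<Rightarrow> nat) set" where
  "colorings G = verts G \<rightarrow>\<^sub>E {0, 1, 2}"

text \<open>On a two-element edge, injectivity of the coloring means that the ends have different colors.\<close>

definition edge_sign :: "('a \<Rightarrow> nat) \<Rightarrow> 'a set \<Rightarrow> real" where
  "edge_sign c e = (if inj_on c e then - 1 else 1)"

definition color_sign :: "nat \<Rightarrow> nat \<Rightarrow> real" where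
  "color_sign a b = (if a = b then 1 else - 1)"

definition coloring_weight :: "'a ugraph \<Rightarrow> ('a \<Rightarrow> nat) \<Rightarrow> real" where
  "coloring_weight G c = (\<Prod>e\<in>edges G. edge_sign c e)"

lemma finite_edges: "simple_graph G \<Longrightarrow> finite (edges G)"
  unfolding simple_graph_def by (meson PowI finite_Pow_iff finite_subset subsetI)

lemma finite_colorings: "simple_graph G \<Longrightarrow> finite (colorings G)"
  unfolding simple_graph_def colorings_def by (intro finite_PiE) auto

lemma edge_sign_doubleton: "x \<noteq> y \<Longrightarrow> edge_sign c {x, y} = color_sign (c x) (c y)"
  by (auto simp: edge_sign_def color_sign_def)

lemma proper_3_colorings_spanning_subgraph:
  assumes "simple_graph G" "E' \<subseteq> edges G"
  shows "proper_3_colorings (spanning_subgraph G E') = {c \<in> colorings G. \<forall>e\<in>E'. inj_on c e}"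
proof -
  have "(\<forall>x y. {x, y} \<in> E' \<longrightarrow> c x \<noteq> c y) \<longleftrightarrow> (\<forall>e\<in>E'. inj_on c e)" for c :: "'a \<Rightarrow> nat"
  proof
    assume *: "\<forall>x y. {x, y} \<in> E' \<longrightarrow> c x \<noteq> c y"
    show "\<forall>e\<in>E'. inj_on c e"
    proof
      fix e assume "e \<in> E'"
      then have "card e = 2" using assms by (auto simp: simple_graph_def)
      then obtain x y where "e = {x, y}" "x \<noteq> y" by (auto simp: card_2_iff)
      then show "inj_on c e" using * \<open>e \<in> E'\<close> by auto
    qed
  next
    assume *: "\<forall>e\<in>E'. inj_on c e"
    show "\<forall>x y. {x, y} \<in> E' \<longrightarrow> c x \<noteq> c y"
    proof (intro allI impI)
      fix x y assume e: "{x, y} \<in> E'"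
      then have "card {x, y} = 2" using assms by (auto simp: simple_graph_def)
      then have "x \<noteq> y" by auto
      then show "c x \<noteq> c y" using * e by (auto dest: inj_onD)
    qed
  qed
  then show ?thesis
    by (simp add: proper_3_colorings_def spanning_subgraph_def colorings_def)
qed

text \<open>The binomial expansion of a product over edges of \<open>(-2) + 1\<close> (bichromatic) or \<open>0 + 1\<close>
  (monochromatic), read from right to left.\<close>

lemma phi_eq_sum_coloring_weight:
  assumes "simple_graph G"
  shows "phi G = 2 powi (- 3 * int (card (verts G))) * (\<Sum>c\<in>colorings G. coloring_weight G c)"
proof -
  let ?f = "\<lambda>(c :: 'a \<Rightarrow> nat) e. (if inj_on c e then - 2 else 0 :: real)"
  have expand: "coloring_weight G c = (\<Sum>E'\<in>Pow (edges G). \<Prod>e\<in>E'. ?f c e)" for c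
  proof -
    have "coloring_weight G c = (\<Prod>e\<in>edges G. ?f c e + 1)"
      unfolding coloring_weight_def by (intro prod.cong) (auto simp: edge_sign_def)
    also have "\<dots> = (\<Sum>E'\<in>Pow (edges G). \<Prod>e\<in>E'. ?f c e)"
      using finite_edges[OF assms] by (simp add: prod_add)
    finally show ?thesis .
  qed
  have count: "(- 2) ^ card E' * real (chi3 (spanning_subgraph G E'))
      = (\<Sum>c\<in>colorings G. \<Prod>e\<in>E'. ?f c e)" if E': "E' \<in> Pow (edges G)" for E'
  proof -
    have fin: "finite E'" using E' finite_edges[OF assms] finite_subset by auto
    have "(\<Prod>e\<in>E'. ?f c e) = (if \<forall>e\<in>E'. inj_on c e then (- 2) ^ card E' else 0)" for c
    proof (cases "\<forall>e\<in>E'. inj_on c e")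
      case False
      then show ?thesis using fin by (subst prod_zero) auto
    qed simp
    then have "(\<Sum>c\<in>colorings G. \<Prod>e\<in>E'. ?f c e)
        = (\<Sum>c\<in>{c \<in> colorings G. \<forall>e\<in>E'. inj_on c e}. (- 2) ^ card E')"
      by (simp only: sum.inter_filter[OF finite_colorings[OF assms]])
    also have "\<dots> = (- 2) ^ card E' * real (chi3 (spanning_subgraph G E'))"
      using E' by (simp add: chi3_def proper_3_colorings_spanning_subgraph[OF assms])
    finally show ?thesis by simp
  qed
  have "(\<Sum>E'\<in>Pow (edges G). (- 2) ^ card E' * real (chi3 (spanning_subgraph G E')))
      = (\<Sum>c\<in>colorings G. coloring_weight G c)"
    unfolding expand by (subst sum.swap) (intro sum.cong refl count)
  then show ?thesis by (simp add: phi_def)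
qed

section \<open>Adding vertices and edges\<close>

lemma simple_graph_add_vertex:
  assumes "simple_graph G" "N \<subseteq> verts G" "p \<notin> verts G"
  shows "simple_graph (add_vertex p N G)"
proof -
  have "card {p, w} = 2" if "w \<in> N" for w
  proof -
    have "p \<noteq> w" using that assms by auto
    then show ?thesis by simp
  qed
  then show ?thesis using assms by (auto simp: simple_graph_def add_vertex_def)
qed

lemma simple_graph_add_edge:
  "simple_graph G \<Longrightarrow> p \<in> verts G \<Longrightarrow> q \<in> verts G \<Longrightarrow> p \<noteq> q \<Longrightarrow> simple_graph (add_edge p q G)"
  by (auto simp: simple_graph_def add_edge_def)

lemma verts_add_vertex: "verts (add_vertex p N G) = insert p (verts G)"
  by (simp add: add_vertex_def)

lemma verts_add_edge: "verts (add_edge p q G) = verts G"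
  by (simp add: add_edge_def)

lemma coloring_weight_cong:
  assumes "simple_graph G" "\<And>x. x \<in> verts G \<Longrightarrow> c x = d x"
  shows "coloring_weight G c = coloring_weight G d"
proof -
  have "inj_on c e = inj_on d e" if "e \<in> edges G" for e
    using assms that by (intro inj_on_cong) (auto simp: simple_graph_def)
  then show ?thesis by (simp add: coloring_weight_def edge_sign_def)
qed

lemma coloring_weight_add_edge:
  assumes "simple_graph G" "{p, q} \<notin> edges G" "p \<noteq> q"
  shows "coloring_weight (add_edge p q G) c = color_sign (c p) (c q) * coloring_weight G c"
  using assms finite_edges[OF assms(1)]
  by (simp add: coloring_weight_def add_edge_def edge_sign_doubleton)

lemma coloring_weight_add_vertex:
  assumes G: "simple_graph G" and N: "N \<subseteq> verts G" and p: "p \<notin> verts G"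
  shows "coloring_weight (add_vertex p N G) c
    = coloring_weight G c * (\<Prod>w\<in>N. color_sign (c p) (c w))"
proof -
  have star: "{{p, w} |w. w \<in> N} = (\<lambda>w. {p, w}) ` N" by auto
  have disj: "edges G \<inter> (\<lambda>w. {p, w}) ` N = {}"
    using G p by (auto simp: simple_graph_def)
  have "finite N" using G N by (auto simp: simple_graph_def intro: finite_subset)
  moreover have "inj_on (\<lambda>w. {p, w}) N" by (auto simp: inj_on_def doubleton_eq_iff)
  moreover have "edge_sign c {p, w} = color_sign (c p) (c w)" if "w \<in> N" for w
    using that N p by (intro edge_sign_doubleton) auto
  ultimately show ?thesis
    using finite_edges[OF G] disj
    by (simp add: coloring_weight_def add_vertex_def star prod.union_disjoint prod.reindex)
qed

text \<open>The summation of the weights over the color \<^term>\<open>a\<close> of a new vertex. The arbitrary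
  observable \<^term>\<open>F\<close> allows the lemma to be iterated, and to carry the sign of an edge between
  two new vertices.\<close>

lemma sum_colorings_add_vertex:
  fixes F :: "('a \<Rightarrow> nat) \<Rightarrow> real"
  assumes G: "simple_graph G" and N: "N \<subseteq> verts G" and p: "p \<notin> verts G"
  shows "(\<Sum>c\<in>colorings (add_vertex p N G). coloring_weight (add_vertex p N G) c * F c)
    = (\<Sum>g\<in>colorings G. coloring_weight G g *
        (\<Sum>a\<in>{0, 1, 2}. (\<Prod>w\<in>N. color_sign a (g w)) * F (g(p := a))))"
proof -
  let ?K = "{0, 1, 2 :: nat}" and ?G = "add_vertex p N G"
  have eq: "coloring_weight ?G (g(p := a)) * F (g(p := a))
      = coloring_weight G g * ((\<Prod>w\<in>N. color_sign a (g w)) * F (g(p := a)))" for g a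
  proof -
    have "coloring_weight G (g(p := a)) = coloring_weight G g"
      using p by (intro coloring_weight_cong[OF G]) auto
    moreover have "(\<Prod>w\<in>N. color_sign a ((g(p := a)) w)) = (\<Prod>w\<in>N. color_sign a (g w))"
      using N p by (intro prod.cong) auto
    ultimately show ?thesis by (simp add: coloring_weight_add_vertex[OF assms])
  qed
  have cols: "colorings ?G = (\<lambda>(a, g). g(p := a)) ` (?K \<times> colorings G)"
    unfolding colorings_def verts_add_vertex by (rule PiE_insert_eq)
  have inj: "inj_on (\<lambda>(a, g). g(p := a)) (?K \<times> colorings G)"
    unfolding colorings_def using p by (rule inj_combinator)
  have "(\<Sum>c\<in>colorings ?G. coloring_weight ?G c * F c)
      = (\<Sum>(a, g)\<in>?K \<times> colorings G. coloring_weight ?G (g(p := a)) * F (g(p := a)))"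
    unfolding cols by (subst sum.reindex[OF inj]) (simp add: case_prod_unfold)
  also have "\<dots> = (\<Sum>a\<in>?K. \<Sum>g\<in>colorings G.
      coloring_weight G g * ((\<Prod>w\<in>N. color_sign a (g w)) * F (g(p := a))))"
    by (simp only: sum.cartesian_product[symmetric] eq)
  finally show ?thesis by (subst (asm) sum.swap) (simp only: sum_distrib_left)
qed

section \<open>Merging two vertices\<close>

text \<open>The factors over the common part \<^term>\<open>A \<inter> B\<close> occur twice and cancel, being square roots
  of 1.\<close>

lemma prod_mult_prod_eq_prod_sym_diff:
  fixes f :: "'a \<Rightarrow> 'b :: comm_monoid_mult"
  assumes "finite A" "finite B" and square: "\<And>x. x \<in> A \<inter> B \<Longrightarrow> f x * f x = 1"
  shows "prod f A * prod f B = prod f (sym_diff A B)"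
proof -
  have "prod f A * prod f B
      = (prod f (A - B) * prod f (A \<inter> B)) * (prod f (B - A) * prod f (A \<inter> B))"
    using prod.Int_Diff[OF assms(1), of f B] prod.Int_Diff[OF assms(2), of f A]
    by (simp add: ac_simps Int_commute)
  also have "\<dots> = prod f (A - B) * prod f (B - A) * (\<Prod>x\<in>A \<inter> B. f x * f x)"
    by (simp add: prod.distrib ac_simps)
  also have "\<dots> = prod f (A - B) * prod f (B - A)"
    using square by simp
  also have "\<dots> = prod f (sym_diff A B)"
    using assms by (subst prod.union_disjoint) auto
  finally show ?thesis .
qed

theorem theorem3p3:
  fixes H :: "'a ugraph" and u v :: "'a set" and p q r :: 'a
  assumes "simple_graph H"
    and "u \<subseteq> verts H" and "v \<subseteq> verts H"
    and "p \<notin> verts H" and "q \<notin> verts H" and "p \<noteq> q"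
    and "r \<notin> verts H"
  defines "G0 \<equiv> add_vertex q v (add_vertex p u H)"
    and "G1 \<equiv> add_edge p q (add_vertex q v (add_vertex p u H))"
    and "Gc \<equiv> add_vertex r (sym_diff u v) H"
  shows "phi G1 = - phi G0 + 1 / 4 * phi Gc"
proof -
  let ?n = "card (verts H)" and ?Hp = "add_vertex p u H" and ?K = "{0, 1, 2 :: nat}"
  let ?Z = "\<lambda>G :: 'a ugraph. \<Sum>c\<in>colorings G. coloring_weight G c"
  note H = assms(1)
  have finV: "finite (verts H)" using H by (simp add: simple_graph_def)
  have Hp: "simple_graph ?Hp" using assms by (intro simple_graph_add_vertex)
  have vHp: "v \<subseteq> verts ?Hp" and qHp: "q \<notin> verts ?Hp"
    using assms by (auto simp: verts_add_vertex)
  have G0: "simple_graph G0"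
    unfolding G0_def using Hp vHp qHp by (rule simple_graph_add_vertex)
  have G1: "simple_graph G1"
    unfolding G1_def using G0 \<open>p \<noteq> q\<close>
    by (intro simple_graph_add_edge) (auto simp: G0_def verts_add_vertex)
  have d: "sym_diff u v \<subseteq> verts H" using assms by auto
  have Gc: "simple_graph Gc"
    unfolding Gc_def using H d \<open>r \<notin> verts H\<close> by (rule simple_graph_add_vertex)
  have pq: "{p, q} \<notin> edges G0"
  proof -
    have "\<forall>e\<in>edges H. p \<notin> e" using H assms(4) by (auto simp: simple_graph_def)
    then show ?thesis
      using assms(2-6) by (auto simp: G0_def add_vertex_def doubleton_eq_iff)
  qed
  \<comment> \<open>This is the double application of \<open>sum_colorings_add_vertex\<close> with observable
    \<open>1 + color_sign (c p) (c q)\<close>, which is 0 unless \<open>b = a\<close>, so that the sum over \<open>b\<close>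
    collapses to one term.\<close>
  have merge: "(\<Sum>a\<in>?K. (\<Prod>w\<in>u. color_sign a (g w)) *
        (\<Sum>b\<in>?K. (\<Prod>w\<in>v. color_sign b ((g(p := a)) w)) *
          (1 + color_sign (((g(p := a))(q := b)) p) (((g(p := a))(q := b)) q))))
      = 2 * (\<Sum>a\<in>?K. \<Prod>w\<in>sym_diff u v. color_sign a (g w))" for g
  proof -
    have "(\<Sum>b\<in>?K. (\<Prod>w\<in>v. color_sign b ((g(p := a)) w)) *
          (1 + color_sign (((g(p := a))(q := b)) p) (((g(p := a))(q := b)) q)))
        = 2 * (\<Prod>w\<in>v. color_sign a (g w))" if "a \<in> ?K" for a
    proof -
      have "(\<Prod>w\<in>v. color_sign b ((g(p := a)) w)) = (\<Prod>w\<in>v. color_sign b (g w))" for b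
        using assms by (intro prod.cong) auto
      then have "(\<Sum>b\<in>?K. (\<Prod>w\<in>v. color_sign b ((g(p := a)) w)) *
          (1 + color_sign (((g(p := a))(q := b)) p) (((g(p := a))(q := b)) q)))
        = (\<Sum>b\<in>?K. if a = b then 2 * (\<Prod>w\<in>v. color_sign b (g w)) else 0)"
        using \<open>p \<noteq> q\<close> by (intro sum.cong) (auto simp: color_sign_def)
      also have "\<dots> = 2 * (\<Prod>w\<in>v. color_sign a (g w))"
        using that by (subst sum.delta') auto
      finally show ?thesis .
    qed
    moreover have "(\<Prod>w\<in>u. color_sign a (g w)) * (\<Prod>w\<in>v. color_sign a (g w))
        = (\<Prod>w\<in>sym_diff u v. color_sign a (g w))" for a
      using assms finV
      by (intro prod_mult_prod_eq_prod_sym_diff) (auto simp: color_sign_def intro: finite_subset)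
    ultimately show ?thesis
      by (simp add: sum_distrib_left mult.left_commute cong: sum.cong)
  qed
  have "?Z G1 + ?Z G0
      = (\<Sum>c\<in>colorings G0. coloring_weight G0 c * (1 + color_sign (c p) (c q)))"
  proof -
    have "coloring_weight G1 c = color_sign (c p) (c q) * coloring_weight G0 c" for c
      unfolding G1_def G0_def[symmetric]
      using G0 pq \<open>p \<noteq> q\<close> by (rule coloring_weight_add_edge)
    moreover have "colorings G1 = colorings G0"
      by (simp add: colorings_def G1_def G0_def verts_add_edge)
    ultimately show ?thesis
      by (simp add: sum.distrib[symmetric] algebra_simps)
  qed
  also have "\<dots> = (\<Sum>g\<in>colorings H. coloring_weight H g *
      (2 * (\<Sum>a\<in>?K. \<Prod>w\<in>sym_diff u v. color_sign a (g w))))"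
    unfolding G0_def sum_colorings_add_vertex[OF Hp vHp qHp]
      sum_colorings_add_vertex[OF assms(1,2,4)] merge ..
  also have "\<dots> = 2 * ?Z Gc"
    using sum_colorings_add_vertex[OF H d \<open>r \<notin> verts H\<close>, of "\<lambda>_. 1"]
    by (simp only: Gc_def mult_1_right sum_distrib_left mult.left_commute)
  finally have Z: "?Z G1 + ?Z G0 = 2 * ?Z Gc" .
  have cards: "card (verts G0) = ?n + 2" "card (verts G1) = ?n + 2" "card (verts Gc) = ?n + 1"
    using assms(4-7) finV by (simp_all add: G0_def G1_def Gc_def verts_add_vertex verts_add_edge)
  have pow: "(2 :: real) powi (- 3 * int (?n + 2)) = 1 / 8 * 2 powi (- 3 * int (?n + 1))"
  proof -
    have "- 3 * int (?n + 2) = - 3 * int (?n + 1) + (- 3)" by simp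
    then have "(2 :: real) powi (- 3 * int (?n + 2)) = 2 powi (- 3 * int (?n + 1)) * 2 powi (- 3)"
      by (metis power_int_add zero_neq_numeral)
    then show ?thesis by (simp add: power_int_minus)
  qed
  have "phi G1 + phi G0 = 2 powi (- 3 * int (?n + 2)) * (?Z G1 + ?Z G0)"
    by (simp only: phi_eq_sum_coloring_weight[OF G1] phi_eq_sum_coloring_weight[OF G0]
        cards distrib_left)
  also have "\<dots> = 1 / 4 * phi Gc"
    by (simp only: Z pow phi_eq_sum_coloring_weight[OF Gc] cards)
  finally show ?thesis by simp
qed

end
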